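(* Let $n$ and $k$ be integers with $1\le k\le n-1$, and let $G$ be a connected graph with $n$ vertices and edge connectivity $\kappa'(G)\le k$. Then $$SO(G)\leq k\sqrt{k^{2}+(n-1)^{2}}+k(n-k-1)\sqrt{(n-1)^{2}+(n-2)^{2}}+\frac{\sqrt{2}}{2}k(k-1)(n-1)+\frac{\sqrt{2}}{2}(n-k-1)(n-k-2)(n-2),$$ with equality if and only if $G\cong K_{n}^{k}$.
   Context: All graphs are finite, simple, undirected and connected. For a graph $G$, $d(u)$ denotes the degree of vertex $u$, and the Sombor index is $SO(G)=\sum_{uv\in E(G)}\sqrt{d(u)^{2}+d(v)^{2}}$. $\kappa'(G)$ is the usual edge connectivity of $G$: the largest $k$ such that $G$ (with at least 2 vertices) cannot be disconnected by deleting fewer than $k$ edges. $K_m$ denotes the complete graph on $m$ vertices. The graph $K_n^k$ is obtained from the disjoint union of $K_1$, $K_k$ and $K_{n-k-1}$ by adding all edges between $K_1$ and $K_k$ and all edges between $K_k$ and $K_{n-k-1}$ (and no edges between $K_1$ and $K_{n-k-1}$); for $k=n-1$ the part $K_{n-k-1}$ is empty and $K_n^{n-1}\cong K_n$. *)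

theory Defs
  imports Complex_Main "Graph_Theory.Graph_Theory"
begin

text \<open>
  A finite simple undirected graph is a \<open>pair_graph\<close>: a finite, loopless, symmetric digraph
  without parallel arcs. An undirected edge \<open>{u, v}\<close> is represented there by the two arcs
  \<open>(u, v)\<close> and \<open>(v, u)\<close>; counting and deleting edges therefore goes through
  \<open>uedges\<close>, in which each edge occurs once.
\<close>

definition uedges :: "'a pair_pre_digraph \<Rightarrow> 'a set set" where
  "uedges G = {{u, v} | u v. (u, v) \<in> parcs G}"

text \<open>By symmetry, the out-degree of a vertex is the number of its neighbours.\<close>

abbreviation deg :: "'a pair_pre_digraph \<Rightarrow> 'a \<Rightarrow> nat" where
  "deg G v \<equiv> out_degree (with_proj G) v"

text \<open>
  The inner sum has exactly the two summands belonging to the ends of the edge \<open>e\<close>,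
  since there are no loops; see \<open>sombor_summand\<close> below.
\<close>

definition sombor_index :: "'a pair_pre_digraph \<Rightarrow> real" where
  "sombor_index G = (\<Sum>e\<in>uedges G. sqrt (\<Sum>w\<in>e. (real (deg G w))\<^sup>2))"

lemma (in pair_graph) sombor_summand:
  assumes "(u, v) \<in> parcs G"
  shows "sqrt (\<Sum>w\<in>{u, v}. (real (deg G w))\<^sup>2) = sqrt ((real (deg G u))\<^sup>2 + (real (deg G v))\<^sup>2)"
  using no_loops'[OF assms] by simp

definition del_uedges :: "'a pair_pre_digraph \<Rightarrow> 'a set set \<Rightarrow> 'a pair_pre_digraph" where
  "del_uedges G F = \<lparr>pverts = pverts G, parcs = {(u, v) \<in> parcs G. {u, v} \<notin> F}\<rparr>"

text \<open>
  The name \<open>connected\<close> alone could also mean topological connectedness, so it is qualified.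
  The maximum is over a finite nonempty set whenever \<open>G\<close> has at least two vertices
  (lemma \<open>edge_connectivity_bounds\<close>); for a single vertex it has no meaning.
\<close>

definition edge_connectivity :: "'a pair_pre_digraph \<Rightarrow> nat" where
  "edge_connectivity G =
     Max {k. \<forall>F \<subseteq> uedges G. card F < k \<longrightarrow> Digraph_Component.connected (with_proj (del_uedges G F))}"

lemma edge_connectivity_bounds:
  assumes "card (pverts G) \<ge> 2"
  shows "{k. \<forall>F \<subseteq> uedges G. card F < k \<longrightarrow> Digraph_Component.connected (with_proj (del_uedges G F))}
           \<subseteq> {..card (uedges G)}"
proof -
  have no_arcs: "parcs (mk_symmetric (with_proj (del_uedges G (uedges G)))) = {}"
    by (auto simp: mk_symmetric_def del_uedges_def uedges_def)
  have verts: "pverts (mk_symmetric (with_proj (del_uedges G (uedges G)))) = pverts G"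
    by (simp add: del_uedges_def)
  obtain x y where xy: "x \<in> pverts G" "y \<in> pverts G" "x \<noteq> y"
    using assms by (metis One_nat_def card_le_Suc0_iff_eq card.infinite not_less_eq_eq
        numeral_2_eq_2 zero_le)
  have "\<not> Digraph_Component.connected (with_proj (del_uedges G (uedges G)))"
  proof
    assume "Digraph_Component.connected (with_proj (del_uedges G (uedges G)))"
    then have "(x, y) \<in> rtrancl_on (pverts G) {}"
      using xy unfolding Digraph_Component.connected_def strongly_connected_def reachable_def
      by (simp add: no_arcs verts del: pverts_mk_symmetric)
    then show False
      using xy(3) by (cases rule: rtrancl_on.cases) auto
  qed
  then show ?thesis by (auto simp: not_less[symmetric])
qed

text \<open>
  The graph on \<open>{0, \<dots>, n - 1}\<close> with parts \<open>{0}\<close>, \<open>{1, \<dots>, k}\<close> and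
  \<open>{k + 1, \<dots>, n - 1}\<close>: the first two parts together induce a complete graph, the last two
  together induce a complete graph, and there are no other edges. Intended for
  \<open>1 \<le> k \<le> n - 1\<close>.
\<close>

definition K_nk :: "nat \<Rightarrow> nat \<Rightarrow> nat pair_pre_digraph" where
  "K_nk n k =
     (let A = {0}; B = {1..k}; C = {k<..<n}
      in \<lparr>pverts = A \<union> B \<union> C,
          parcs = {(u, v) \<in> (A \<union> B) \<times> (A \<union> B) \<union> (B \<union> C) \<times> (B \<union> C). u \<noteq> v}\<rparr>)"

lemma pair_graph_K_nk: "pair_graph (K_nk n k)"
proof
  show "finite (parcs (K_nk n k))"
    by (rule finite_subset[of _ "({0} \<union> {1..k} \<union> {k<..<n}) \<times> ({0} \<union> {1..k} \<union> {k<..<n})"])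
       (auto simp: K_nk_def Let_def)
qed (auto simp: K_nk_def Let_def symmetric_def sym_def)

end

theory Submission
  imports Defs
begin

text \<open>
  The Sombor index strictly increases when edges are added. An edge cut with at most
  \<open>k\<close> edges gives, if \<open>k \<le> n - 2\<close>, a vertex cut \<open>C\<close> of size exactly \<open>k\<close>, so \<open>G\<close> is a
  spanning subgraph of two cliques of sizes \<open>a + k\<close> and \<open>b + k\<close> glued along \<open>C\<close>; if
  \<open>k = n - 1\<close> this holds trivially with \<open>a = 1\<close> and \<open>b = 0\<close>. The index of the glued cliques
  is a constant plus \<open>f a + f b\<close> for a strictly convex \<open>f\<close> (with \<open>a + b = n - k\<close> fixed),
  hence it is largest exactly when one of the sides is a single vertex.
\<close>

section \<open>Degrees, the index as a sum over arcs, and monotonicity in the edge set\<close>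

lemma deg_eq_card_succs:
  "deg G u = card {v. (u, v) \<in> parcs G}"
proof -
  have "out_arcs (with_proj G) u = Pair u ` {v. (u, v) \<in> parcs G}"
    by (auto simp: out_arcs_def)
  then show ?thesis
    by (simp add: out_degree_def card_image inj_on_def)
qed

text \<open>Each edge is the image of exactly two arcs, of equal weight. Unlike edges, arcs can be
  grouped by their tail, which reduces the index to a sum over vertices and their
  neighbours.\<close>

lemma (in pair_graph) sombor_index_arcs:
  "2 * sombor_index G =
     (\<Sum>(u, v)\<in>parcs G. sqrt ((real (deg G u))\<^sup>2 + (real (deg G v))\<^sup>2))"
proof -
  let ?w = "\<lambda>(u, v). sqrt ((real (deg G u))\<^sup>2 + (real (deg G v))\<^sup>2)"
  let ?g = "\<lambda>e. sqrt (\<Sum>w\<in>e. (real (deg G w))\<^sup>2)"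
  let ?E = "\<lambda>(u, v). {u, v}"
  have img: "uedges G = ?E ` parcs G"
    by (auto simp: uedges_def)
  have fibre: "sum ?w {a \<in> parcs G. ?E a = e} = 2 * ?g e" if "e \<in> uedges G" for e
  proof -
    obtain u v where uv: "(u, v) \<in> parcs G" "e = {u, v}"
      using \<open>e \<in> uedges G\<close> by (auto simp: uedges_def)
    have ne: "u \<noteq> v"
      using uv no_loops' by blast
    have "{a \<in> parcs G. ?E a = e} = {(u, v), (v, u)}"
      using uv arcs_symmetric by (auto simp: doubleton_eq_iff)
    then show ?thesis
      using ne uv by (simp add: add.commute)
  qed
  have "2 * sombor_index G = (\<Sum>e\<in>uedges G. 2 * ?g e)"
    by (simp add: sombor_index_def sum_distrib_left)
  also have "\<dots> = (\<Sum>e\<in>uedges G. sum ?w {a \<in> parcs G. ?E a = e})"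
    by (simp add: fibre)
  also have "\<dots> = sum ?w (parcs G)"
    by (rule sum.group) (auto simp: img pair_finite_arcs)
  finally show ?thesis .
qed

text \<open>Passing from \<open>G\<close> to \<open>H\<close> lowers no degree, so no arc of
  \<open>G\<close> loses weight. Every further arc of \<open>H\<close> adds a positive weight, since
  its tail has positive degree in \<open>H\<close>; hence equality leaves no room for further
  arcs.\<close>

lemma sombor_index_spanning_subgraph:
  assumes "pair_graph G" "pair_graph H" "parcs G \<subseteq> parcs H"
  shows "sombor_index G \<le> sombor_index H"
    and "sombor_index G = sombor_index H \<Longrightarrow> parcs G = parcs H"
proof -
  interpret G: pair_graph G by fact
  interpret H: pair_graph H by fact
  let ?w = "\<lambda>K (u, v). sqrt ((real (deg K u))\<^sup>2 + (real (deg K v))\<^sup>2)"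
  have fin: "finite {v. (u, v) \<in> parcs H}" for u
    by (rule finite_subset[of _ "snd ` parcs H"]) (force simp: H.pair_finite_arcs)+
  have deg_mono: "deg G u \<le> deg H u" for u
    unfolding deg_eq_card_succs using assms(3) by (intro card_mono[OF fin]) auto
  have w_mono: "?w G a \<le> ?w H a" for a
    by (cases a) (auto intro!: add_mono power_mono deg_mono)
  have w_pos: "?w H a > 0" if "a \<in> parcs H" for a
  proof -
    obtain u v where a: "a = (u, v)" by force
    have "deg H u > 0"
      unfolding deg_eq_card_succs using that a by (auto simp: card_gt_0_iff fin)
    then show ?thesis by (simp add: a add_pos_nonneg)
  qed
  have split: "2 * sombor_index H = sum (?w H) (parcs H - parcs G) + sum (?w H) (parcs G)"
    unfolding H.sombor_index_arcs
    by (rule sum.subset_diff[OF assms(3) H.pair_finite_arcs])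
  have le: "2 * sombor_index G \<le> sum (?w H) (parcs G)"
    unfolding G.sombor_index_arcs by (intro sum_mono w_mono)
  have nonneg: "0 \<le> sum (?w H) (parcs H - parcs G)"
    by (intro sum_nonneg) auto
  show "sombor_index G \<le> sombor_index H"
    using split le nonneg by linarith
  show "parcs G = parcs H" if "sombor_index G = sombor_index H"
  proof (rule ccontr)
    assume "parcs G \<noteq> parcs H"
    then have "parcs H - parcs G \<noteq> {}" using assms(3) by blast
    then have "0 < sum (?w H) (parcs H - parcs G)"
      by (intro sum_pos w_pos) (auto simp: H.pair_finite_arcs)
    then show False using split le that by linarith
  qed
qed

section \<open>Two cliques sharing a common part, and their Sombor index\<close>

text \<open>For disjoint sets, \<open>C\<close> is the common part and \<open>A\<close>,
  \<open>B\<close> are the two sides. Arbitrary sets are allowed so that one notion covers both a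
  supergraph of \<open>G\<close> on the vertices of \<open>G\<close> and the extremal graph
  \<open>K_nk\<close>.\<close>

definition two_cliques :: "'a set \<Rightarrow> 'a set \<Rightarrow> 'a set \<Rightarrow> 'a pair_pre_digraph" where
  "two_cliques A C B =
     \<lparr>pverts = A \<union> C \<union> B,
      parcs = {(u, v) \<in> (A \<union> C) \<times> (A \<union> C) \<union> (C \<union> B) \<times> (C \<union> B). u \<noteq> v}\<rparr>"

lemma K_nk_eq_two_cliques: "K_nk n k = two_cliques {0} {1..k} {k<..<n}"
  by (simp only: K_nk_def two_cliques_def Let_def)

lemma two_cliques_commute: "two_cliques A C B = two_cliques B C A"
  by (auto simp: two_cliques_def)

lemma pair_graph_two_cliques:
  assumes "finite A" "finite C" "finite B"
  shows "pair_graph (two_cliques A C B)"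
proof
  show "finite (parcs (two_cliques A C B))"
    by (rule finite_subset[of _ "(A \<union> C \<union> B) \<times> (A \<union> C \<union> B)"])
       (use assms in \<open>auto simp: two_cliques_def\<close>)
qed (use assms in \<open>auto simp: two_cliques_def symmetric_def sym_def\<close>)

text \<open>
  The contribution of the edges meeting one side of size \<open>x\<close> when the two cliques share \<open>k\<close>
  vertices, each of degree \<open>c\<close>.
\<close>

definition sombor_side :: "real \<Rightarrow> real \<Rightarrow> real \<Rightarrow> real" where
  "sombor_side k c x =
     sqrt 2 / 2 * x * (x - 1) * (x + k - 1) + k * x * sqrt ((x + k - 1)\<^sup>2 + c\<^sup>2)"

text \<open>Degrees are constant on each part: \<open>a + k - 1\<close> on \<open>A\<close>,
  \<open>a + k + b - 1\<close> on \<open>C\<close>, \<open>b + k - 1\<close> on \<open>B\<close>.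
  Grouping the arcs by tail, each vertex of a part contributes the same amount.\<close>

lemma sombor_index_two_cliques:
  assumes fin: "finite A" "finite C" "finite B"
    and disj: "A \<inter> C = {}" "A \<inter> B = {}" "C \<inter> B = {}"
  defines "a \<equiv> real (card A)" and "k \<equiv> real (card C)" and "b \<equiv> real (card B)"
  shows "sombor_index (two_cliques A C B) =
    sqrt 2 / 2 * k * (k - 1) * (a + k + b - 1)
    + sombor_side k (a + k + b - 1) a + sombor_side k (a + k + b - 1) b"
proof -
  let ?H = "two_cliques A C B"
  let ?V = "A \<union> C \<union> B"
  let ?c = "a + k + b - 1"
  interpret H: pair_graph ?H by (rule pair_graph_two_cliques[OF fin])
  define N where "N u = {v. (u, v) \<in> parcs ?H}" for u
  have N: "N u = (A - {u}) \<union> C" if "u \<in> A" for u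
    using that disj by (auto simp: N_def two_cliques_def)
  have N': "N u = A \<union> (C - {u}) \<union> B" if "u \<in> C" for u
    using that disj by (auto simp: N_def two_cliques_def)
  have N'': "N u = C \<union> (B - {u})" if "u \<in> B" for u
    using that disj by (auto simp: N_def two_cliques_def)
  have card_minus: "real (card (S - {u})) = real (card S) - 1" if "u \<in> S" "finite S" for u :: 'a and S
    using card_Suc_Diff1[OF that(2,1)] by linarith
  have dA: "real (deg ?H u) = a + k - 1" if "u \<in> A" for u
  proof -
    have "card (N u) = card (A - {u}) + card C"
      unfolding N[OF that] by (rule card_Un_disjoint) (use fin disj in auto)
    then show ?thesis
      using card_minus[OF that fin(1)] by (simp add: deg_eq_card_succs N_def a_def k_def)
  qed
  have dC: "real (deg ?H u) = ?c" if "u \<in> C" for u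
  proof -
    have "card (N u) = card (A \<union> (C - {u})) + card B"
      unfolding N'[OF that] by (rule card_Un_disjoint) (use fin disj in auto)
    also have "card (A \<union> (C - {u})) = card A + card (C - {u})"
      by (rule card_Un_disjoint) (use fin disj in auto)
    finally show ?thesis
      using card_minus[OF that fin(2)] by (simp add: deg_eq_card_succs N_def a_def k_def b_def)
  qed
  have dB: "real (deg ?H u) = b + k - 1" if "u \<in> B" for u
  proof -
    have "card (N u) = card C + card (B - {u})"
      unfolding N''[OF that] by (rule card_Un_disjoint) (use fin disj in auto)
    then show ?thesis
      using card_minus[OF that fin(3)] by (simp add: deg_eq_card_succs N_def b_def k_def)
  qed
  define w where "w u v = sqrt ((real (deg ?H u))\<^sup>2 + (real (deg ?H v))\<^sup>2)" for u v
  define q where "q x y = sqrt (x\<^sup>2 + y\<^sup>2)" for x y :: real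
  have q_commute: "q x y = q y x" for x y
    by (simp add: q_def add.commute)
  have q_same: "q x x = sqrt 2 * x" if "x \<ge> 0" for x
  proof -
    have "q x x = sqrt (2 * x\<^sup>2)" by (simp add: q_def)
    then show ?thesis using that by (simp only: real_sqrt_mult real_sqrt_abs abs_of_nonneg)
  qed
  have sA: "sum (w u) (N u) = (a - 1) * q (a+k-1) (a+k-1) + k * q (a+k-1) ?c" if "u \<in> A" for u
  proof -
    have "sum (w u) (N u) = sum (w u) (A - {u}) + sum (w u) C"
      unfolding N[OF that] by (rule sum.union_disjoint) (use fin disj in auto)
    also have "sum (w u) (A - {u}) = (\<Sum>v\<in>A - {u}. q (a+k-1) (a+k-1))"
      by (rule sum.cong) (auto simp: w_def q_def dA that)
    also have "sum (w u) C = (\<Sum>v\<in>C. q (a+k-1) ?c)"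
      by (rule sum.cong) (auto simp: w_def q_def dA dC that)
    finally show ?thesis
      using card_minus[OF that fin(1)] by (simp add: a_def k_def)
  qed
  have sC: "sum (w u) (N u) = a * q ?c (a+k-1) + (k - 1) * q ?c ?c + b * q ?c (b+k-1)" if "u \<in> C" for u
  proof -
    have "sum (w u) (N u) = sum (w u) (A \<union> (C - {u})) + sum (w u) B"
      unfolding N'[OF that] by (rule sum.union_disjoint) (use fin disj in auto)
    also have "sum (w u) (A \<union> (C - {u})) = sum (w u) A + sum (w u) (C - {u})"
      by (rule sum.union_disjoint) (use fin disj in auto)
    also have "sum (w u) A = (\<Sum>v\<in>A. q ?c (a+k-1))"
      by (rule sum.cong) (auto simp: w_def q_def dA dC that)
    also have "sum (w u) (C - {u}) = (\<Sum>v\<in>C - {u}. q ?c ?c)"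
      by (rule sum.cong) (auto simp: w_def q_def dC that)
    also have "sum (w u) B = (\<Sum>v\<in>B. q ?c (b+k-1))"
      by (rule sum.cong) (auto simp: w_def q_def dB dC that)
    finally show ?thesis
      using card_minus[OF that fin(2)] by (simp add: a_def k_def b_def)
  qed
  have sB: "sum (w u) (N u) = k * q (b+k-1) ?c + (b - 1) * q (b+k-1) (b+k-1)" if "u \<in> B" for u
  proof -
    have "sum (w u) (N u) = sum (w u) C + sum (w u) (B - {u})"
      unfolding N''[OF that] by (rule sum.union_disjoint) (use fin disj in auto)
    also have "sum (w u) (B - {u}) = (\<Sum>v\<in>B - {u}. q (b+k-1) (b+k-1))"
      by (rule sum.cong) (auto simp: w_def q_def dB that)
    also have "sum (w u) C = (\<Sum>v\<in>C. q (b+k-1) ?c)"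
      by (rule sum.cong) (auto simp: w_def q_def dB dC that)
    finally show ?thesis
      using card_minus[OF that fin(3)] by (simp add: b_def k_def)
  qed
  have finN: "finite (N u)" for u
    by (rule finite_subset[of _ ?V]) (use fin in \<open>auto simp: N_def two_cliques_def\<close>)
  have "2 * sombor_index ?H = (\<Sum>(u, v)\<in>parcs ?H. w u v)"
    by (simp add: H.sombor_index_arcs w_def)
  also have "parcs ?H = Sigma ?V N"
    by (auto simp: N_def two_cliques_def)
  also have "(\<Sum>(u, v)\<in>Sigma ?V N. w u v) = (\<Sum>u\<in>?V. sum (w u) (N u))"
    by (rule sum.Sigma[symmetric]) (use fin finN in auto)
  also have "\<dots> = (\<Sum>u\<in>A \<union> C. sum (w u) (N u)) + (\<Sum>u\<in>B. sum (w u) (N u))"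
    by (rule sum.union_disjoint) (use fin disj in auto)
  also have "(\<Sum>u\<in>A \<union> C. sum (w u) (N u)) = (\<Sum>u\<in>A. sum (w u) (N u)) + (\<Sum>u\<in>C. sum (w u) (N u))"
    by (rule sum.union_disjoint) (use fin disj in auto)
  also have "(\<Sum>u\<in>A. sum (w u) (N u)) = a * ((a - 1) * q (a+k-1) (a+k-1) + k * q (a+k-1) ?c)"
    by (simp add: sA a_def)
  also have "(\<Sum>u\<in>C. sum (w u) (N u)) =
      k * (a * q ?c (a+k-1) + (k - 1) * q ?c ?c + b * q ?c (b+k-1))"
    by (simp add: sC k_def)
  also have "(\<Sum>u\<in>B. sum (w u) (N u)) = b * (k * q (b+k-1) ?c + (b - 1) * q (b+k-1) (b+k-1))"
    by (simp add: sB b_def)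
  finally have total: "2 * sombor_index ?H =
      a * (a - 1) * q (a+k-1) (a+k-1) + k * (k - 1) * q ?c ?c + b * (b - 1) * q (b+k-1) (b+k-1)
      + 2 * k * a * q (a+k-1) ?c + 2 * k * b * q (b+k-1) ?c"
    unfolding q_commute[of ?c "a+k-1"] q_commute[of ?c "b+k-1"] by (simp add: algebra_simps)
  \<comment> \<open>For an empty part the degree formula may be negative, where
    \<open>q_same\<close> does not apply; the factor \<open>a\<close>, \<open>k\<close> or
    \<open>b\<close> is then zero.\<close>
  have int: "a = 0 \<or> a \<ge> 1" "b = 0 \<or> b \<ge> 1" "k = 0 \<or> k \<ge> 1" "a \<ge> 0" "b \<ge> 0" "k \<ge> 0"
    by (auto simp: a_def b_def k_def)
  have qA: "a * (a - 1) * q (a+k-1) (a+k-1) = a * (a - 1) * (sqrt 2 * (a+k-1))"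
    using int q_same[of "a+k-1"] by auto
  have qC: "k * (k - 1) * q ?c ?c = k * (k - 1) * (sqrt 2 * ?c)"
    using int q_same[of ?c] by auto
  have qB: "b * (b - 1) * q (b+k-1) (b+k-1) = b * (b - 1) * (sqrt 2 * (b+k-1))"
    using int q_same[of "b+k-1"] by auto
  show ?thesis
    using total[unfolded qA qB qC] unfolding sombor_side_def q_def by (simp add: field_simps)
qed

section \<open>Strict convexity of the side contribution\<close>

text \<open>Both \<open>f a - f 1\<close> and \<open>f (a + b - 1) - f b\<close> telescope into
  \<open>a - 1\<close> consecutive increments, starting at \<open>1\<close> and at \<open>b\<close>.
  The later increments are larger termwise because \<open>b > 1\<close>, and there is at least one
  of them because \<open>a > 1\<close>.\<close>

lemma strict_mono_diff_superadditive:
  fixes f :: "nat \<Rightarrow> real"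
  assumes "strict_mono (\<lambda>x. f (Suc x) - f x)" "2 \<le> a" "2 \<le> b"
  shows "f a + f b < f 1 + f (a + b - 1)"
proof -
  have tel: "(\<Sum>i<a - 1. f (Suc (m + i)) - f (m + i)) = f (m + (a - 1)) - f m" for m
    using sum_lessThan_telescope[of "\<lambda>i. f (m + i)" "a - 1"] by simp
  have "(\<Sum>i<a - 1. f (Suc (1 + i)) - f (1 + i)) < (\<Sum>i<a - 1. f (Suc (b + i)) - f (b + i))"
    using assms(2,3) strict_monoD[OF assms(1)] by (intro sum_strict_mono) (auto simp: lessThan_empty_iff)
  moreover have "1 + (a - 1) = a" "b + (a - 1) = a + b - 1"
    using assms(2,3) by auto
  ultimately show ?thesis
    unfolding tel by simp
qed

text \<open>This is the triangle inequality in the plane for \<open>(y, c)\<close> and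
  \<open>(y + 2, c)\<close>, whose sum is twice \<open>(y + 1, c)\<close>.\<close>

lemma sqrt_sum_squares_midpoint_convex:
  fixes y c :: real
  shows "2 * sqrt ((y + 1)\<^sup>2 + c\<^sup>2) \<le> sqrt (y\<^sup>2 + c\<^sup>2) + sqrt ((y + 2)\<^sup>2 + c\<^sup>2)"
proof -
  have "2 * sqrt ((y + 1)\<^sup>2 + c\<^sup>2) = sqrt (4 * ((y + 1)\<^sup>2 + c\<^sup>2))"
    by (subst real_sqrt_mult) simp
  also have "4 * ((y + 1)\<^sup>2 + c\<^sup>2) = (y + (y + 2))\<^sup>2 + (c + c)\<^sup>2"
    by (simp add: power2_eq_square algebra_simps)
  also have "sqrt \<dots> \<le> sqrt (y\<^sup>2 + c\<^sup>2) + sqrt ((y + 2)\<^sup>2 + c\<^sup>2)"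
    by (rule real_sqrt_sum_squares_triangle_ineq)
  finally show ?thesis .
qed

text \<open>
  The side contribution is \<open>x * h x\<close> with \<open>h\<close> increasing and convex, and
  \<open>(x + 2) * h (x + 2) - 2 * (x + 1) * h (x + 1) + x * h x\<close> equals
  \<open>x * (h (x + 2) - 2 * h (x + 1) + h x) + 2 * (h (x + 2) - h (x + 1))\<close>.
\<close>

lemma strict_mono_diff_sombor_side:
  assumes "1 \<le> k"
  shows "strict_mono (\<lambda>x. sombor_side k c (real (Suc x)) - sombor_side k c (real x))"
proof (subst strict_mono_Suc_iff, intro allI)
  fix n :: nat
  define x where "x = real n"
  have x0: "x \<ge> 0" by (simp add: x_def)
  define r where "r y = k * sqrt ((y + k - 1)\<^sup>2 + c\<^sup>2)" for y
  define p where "p y = sqrt 2 / 2 * ((y - 1) * (y + k - 1))" for y :: real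
  define h where "h y = p y + r y" for y
  have side: "sombor_side k c y = y * h y" for y
    by (simp add: sombor_side_def h_def p_def r_def distrib_left mult_ac)
  have r_conv: "2 * r (x + 1) \<le> r x + r (x + 2)"
  proof -
    have "k * (2 * sqrt ((x + k - 1 + 1)\<^sup>2 + c\<^sup>2))
        \<le> k * (sqrt ((x + k - 1)\<^sup>2 + c\<^sup>2) + sqrt ((x + k - 1 + 2)\<^sup>2 + c\<^sup>2))"
      using assms by (intro mult_left_mono sqrt_sum_squares_midpoint_convex) auto
    then show ?thesis by (simp add: r_def algebra_simps)
  qed
  \<comment> \<open>\<open>p\<close> is quadratic with leading coefficient
    \<open>sqrt 2 / 2\<close>, so its second difference is constant, namely twice that
    coefficient.\<close>
  have p_conv: "p x + p (x + 2) - 2 * p (x + 1) = sqrt 2"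
    by (simp add: p_def field_simps)
  have r_mono: "r (x + 1) \<le> r (x + 2)"
    unfolding r_def using assms x0
    by (intro mult_left_mono real_sqrt_le_mono add_right_mono power_mono) auto
  \<comment> \<open>The strictness of the conclusion is drawn from here: at \<open>x = 0\<close> the
    convexity term is multiplied by zero.\<close>
  have p_mono: "p (x + 1) < p (x + 2)"
  proof -
    have "x * (x + k) < (x + 1) * (x + k + 1)"
      using assms x0 by (simp add: algebra_simps)
    then have "(x + 1 - 1) * (x + 1 + k - 1) < (x + 2 - 1) * (x + 2 + k - 1)"
      by (simp add: algebra_simps)
    then show ?thesis unfolding p_def by (rule mult_strict_left_mono) simp
  qed
  have two: "0 \<le> sqrt (2 :: real)" by simp
  have "0 \<le> h (x + 2) - 2 * h (x + 1) + h x"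
    using p_conv r_conv two unfolding h_def by (simp only: distrib_left)
  then have "0 \<le> x * (h (x + 2) - 2 * h (x + 1) + h x)"
    using x0 by simp
  moreover have "h (x + 1) < h (x + 2)"
    using p_mono r_mono by (simp add: h_def)
  moreover have "real (Suc n) = x + 1" "real (Suc (Suc n)) = x + 2" "real n = x"
    by (auto simp: x_def)
  ultimately show "sombor_side k c (real (Suc n)) - sombor_side k c (real n)
      < sombor_side k c (real (Suc (Suc n))) - sombor_side k c (real (Suc n))"
    by (simp add: side algebra_simps)
qed

section \<open>From an edge cut to a spanning supergraph made of two cliques\<close>

text \<open>By maximality \<open>Suc k\<close> fails the defining condition, so some set
  \<open>F\<close> of at most \<open>k\<close> edges disconnects the graph. The vertices reachable
  from a suitable \<open>x\<close> after deleting \<open>F\<close> form \<open>S\<close>, and only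
  edges of \<open>F\<close> leave it.\<close>

lemma (in pair_graph) edge_cut_of_edge_connectivity_le:
  assumes "2 \<le> card (pverts G)" "edge_connectivity G \<le> k"
  obtains S where "S \<subseteq> pverts G" "S \<noteq> {}" "S \<noteq> pverts G"
    "card (parcs G \<inter> S \<times> (pverts G - S)) \<le> k"
proof -
  let ?K = "{k. \<forall>F \<subseteq> uedges G. card F < k \<longrightarrow> Digraph_Component.connected (with_proj (del_uedges G F))}"
  have "finite ?K"
    by (rule finite_subset[OF edge_connectivity_bounds[OF assms(1)]]) simp
  \<comment> \<open>\<open>Max\<close> bounds the members of \<open>?K\<close> only because
    \<open>?K\<close> is finite, which relies on there being two vertices.\<close>
  then have "Suc k \<notin> ?K"
    using assms(2) Max_ge[of ?K "Suc k"] unfolding edge_connectivity_def by linarith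
  then obtain F where F: "F \<subseteq> uedges G" "card F \<le> k"
    and disc: "\<not> Digraph_Component.connected (with_proj (del_uedges G F))"
    by (auto simp: less_Suc_eq_le)
  have "uedges G = (\<lambda>(u, v). {u, v}) ` parcs G"
    by (auto simp: uedges_def)
  then have "finite F"
    using F(1) pair_finite_arcs by (auto intro: finite_subset)
  let ?D = "mk_symmetric (with_proj (del_uedges G F))"
  \<comment> \<open>Deleting an edge removes both of its arcs, so the symmetric closure adds nothing
    back.\<close>
  have D: "parcs ?D = {(u, v) \<in> parcs G. {u, v} \<notin> F}"
    by (auto simp: parcs_mk_symmetric del_uedges_def insert_commute intro: arcs_symmetric)
  have V: "verts (with_proj ?D) = pverts G"
    by (simp add: del_uedges_def)
  have "pverts G \<noteq> {}" using assms(1) by auto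
  then obtain x y where xy: "x \<in> pverts G" "y \<in> pverts G"
    and no: "(x, y) \<notin> rtrancl_on (pverts G) (parcs ?D)"
    using disc
    by (auto simp: Digraph_Component.connected_def strongly_connected_def reachable_def V
        simp del: pverts_mk_symmetric with_proj_simps(1))
  define S where "S = {w \<in> pverts G. (x, w) \<in> rtrancl_on (pverts G) (parcs ?D)}"
  have cut: "{u, v} \<in> F" if "(u, v) \<in> parcs G \<inter> S \<times> (pverts G - S)" for u v
  proof (rule ccontr)
    assume "{u, v} \<notin> F"
    then have "(u, v) \<in> parcs ?D" using that by (simp add: D)
    then have "(x, v) \<in> rtrancl_on (pverts G) (parcs ?D)"
      using that by (auto simp: S_def intro: rtrancl_on_into_rtrancl_on)
    then show False using that by (auto simp: S_def)
  qed
  \<comment> \<open>Only one of the two arcs of a crossing edge starts in \<open>S\<close>, so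
    sending an arc to its edge is injective here.\<close>
  have "card (parcs G \<inter> S \<times> (pverts G - S)) \<le> card F"
    by (rule card_inj_on_le[of "\<lambda>(u, v). {u, v}"])
       (use cut \<open>finite F\<close> in \<open>auto simp: inj_on_def doubleton_eq_iff\<close>)
  moreover have "x \<in> S" "y \<notin> S" "S \<subseteq> pverts G"
    using xy no by (auto simp: S_def)
  ultimately show thesis
    using that[of S] F(2) xy by auto
qed

text \<open>
  Some \<open>x \<in> S\<close> and \<open>y \<notin> S\<close> are non-adjacent, as otherwise the cut would have at least
  \<open>n - 1\<close> edges; picking from each cut edge an end other than \<open>x\<close> and \<open>y\<close> yields a vertex cut.
\<close>

lemma (in pair_graph) subgraph_two_cliques_of_edge_cut:
  assumes S: "S \<subseteq> pverts G" "S \<noteq> {}" "S \<noteq> pverts G"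
    and cut: "card (parcs G \<inter> S \<times> (pverts G - S)) \<le> k"
    and k: "k + 2 \<le> card (pverts G)"
  obtains A C B where "A \<inter> C = {}" "A \<inter> B = {}" "C \<inter> B = {}" "pverts G = A \<union> C \<union> B"
    "A \<noteq> {}" "B \<noteq> {}" "card C = k" "parcs G \<subseteq> parcs (two_cliques A C B)"
proof -
  let ?V = "pverts G"
  let ?T = "?V - S"
  let ?X = "parcs G \<inter> S \<times> ?T"
  have finS: "finite S" "finite ?T"
    using finite_subset[OF S(1)] pair_finite_verts by auto
  have "\<exists>x\<in>S. \<exists>y\<in>?T. (x, y) \<notin> parcs G"
  proof (rule ccontr)
    assume "\<not> ?thesis"
    then have "?X = S \<times> ?T" by auto
    then have le: "card S * card ?T \<le> k"
      using cut by (simp add: card_cartesian_product)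
    have "card ?V = card S + card ?T"
      using S(1) pair_finite_verts finS by (metis add_diff_inverse_nat card_Diff_subset card_mono not_less)
    \<comment> \<open>With sides of sizes \<open>s + 1\<close> and \<open>t + 1\<close> the product
      is at least \<open>s + t + 1\<close>, one less than the number of vertices and hence more than
      \<open>k\<close>.\<close>
    moreover obtain s where "card S = Suc s"
      using S(2) finS(1) by (metis card_0_eq not0_implies_Suc)
    moreover obtain t where "card ?T = Suc t"
      using S(1,3) finS(2) by (metis Diff_eq_empty_iff card_0_eq not0_implies_Suc subset_antisym)
    ultimately show False
      using le k by simp
  qed
  then obtain x y where xy: "x \<in> S" "y \<in> ?T" "(x, y) \<notin> parcs G"
    by auto
  \<comment> \<open>The chosen end is never \<open>x\<close>; it is never \<open>y\<close> either,
    because the arc \<open>(x, y)\<close> is absent.\<close>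
  define r where "r = (\<lambda>(s, t). if s = x then t else s)"
  have r_sub: "r ` ?X \<subseteq> ?V - {x, y}"
    using xy S(1) by (auto simp: r_def split: if_splits)
  have "card (r ` ?X) \<le> k"
    using cut card_image_le[of ?X r] pair_finite_arcs by simp
  moreover have "k \<le> card (?V - {x, y})"
  proof -
    have "card (?V - {x, y}) = card ?V - card {x, y}"
      using xy S(1) by (intro card_Diff_subset) auto
    moreover have "x \<noteq> y"
      using xy by blast
    ultimately show ?thesis using k by (simp add: card_insert_if)
  qed
  \<comment> \<open>The vertex cut is padded to size exactly \<open>k\<close>. Keeping
    \<open>x\<close> and \<open>y\<close> outside leaves both sides nonempty.\<close>
  ultimately obtain C where C: "r ` ?X \<subseteq> C" "C \<subseteq> ?V - {x, y}" "card C = k"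
    using exists_subset_between[OF _ _ r_sub] pair_finite_verts by blast
  have cover: "s \<in> C \<or> t \<in> C" if "(s, t) \<in> parcs G" "s \<in> S" "t \<in> ?T" for s t
  proof -
    have "r (s, t) \<in> C" using that C(1) by blast
    then show ?thesis by (auto simp: r_def split: if_splits)
  qed
  show thesis
  proof (rule that[of "S - C" C "?T - C"])
    show "parcs G \<subseteq> parcs (two_cliques (S - C) C (?T - C))"
    proof (rule subrelI)
      fix u v assume uv: "(u, v) \<in> parcs G"
      then have "(v, u) \<in> parcs G" "u \<noteq> v" "u \<in> ?V" "v \<in> ?V"
        using arcs_symmetric no_loops' wellformed' by blast+
      then show "(u, v) \<in> parcs (two_cliques (S - C) C (?T - C))"
        using uv cover[of u v] cover[of v u] by (auto simp: two_cliques_def)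
    qed
    show "?V = S - C \<union> C \<union> (?T - C)"
      using S(1) C(2) by auto
  qed (use xy C in auto)
qed

section \<open>Isomorphism of glued cliques in terms of part sizes\<close>

text \<open>Adjacency of distinct vertices depends only on the parts containing them, so any three
  bijections between corresponding parts combine to an isomorphism.\<close>

lemma digraph_iso_two_cliquesI:
  assumes wf: "pair_wf_digraph G"
    and G: "pverts G = A \<union> C \<union> B" "parcs G = parcs (two_cliques A C B)"
    and fin: "finite A" "finite C" "finite B" "finite A'" "finite C'" "finite B'"
    and disj: "A \<inter> C = {}" "A \<inter> B = {}" "C \<inter> B = {}" "A' \<inter> C' = {}" "A' \<inter> B' = {}" "C' \<inter> B' = {}"
    and card: "card A = card A'" "card C = card C'" "card B = card B'"
  shows "digraph_iso (with_proj G) (with_proj (two_cliques A' C' B'))"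
proof -
  obtain f g h where fgh: "bij_betw f A A'" "bij_betw g C C'" "bij_betw h B B'"
    using fin card finite_same_card_bij by metis
  define p where "p v = (if v \<in> A then f v else if v \<in> C then g v else h v)" for v
  have A: "bij_betw p A A'"
    using fgh(1) by (rule bij_betw_cong[THEN iffD1, rotated]) (auto simp: p_def)
  have C: "bij_betw p C C'"
    using fgh(2) by (rule bij_betw_cong[THEN iffD1, rotated]) (use disj in \<open>auto simp: p_def\<close>)
  have B: "bij_betw p B B'"
    using fgh(3) by (rule bij_betw_cong[THEN iffD1, rotated]) (use disj in \<open>auto simp: p_def\<close>)
  have AC: "bij_betw p (A \<union> C) (A' \<union> C')"
    using A C disj(4) by (rule bij_betw_combine)
  have CB: "bij_betw p (C \<union> B) (C' \<union> B')"
    using C B disj(6) by (rule bij_betw_combine)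
  have V: "bij_betw p (A \<union> C \<union> B) (A' \<union> C' \<union> B')"
    using AC B by (rule bij_betw_combine) (use disj in auto)
  have inj: "inj_on p (A \<union> C \<union> B)"
    using V by (rule bij_betw_imp_inj_on)
  \<comment> \<open>Here \<open>X\<close> and \<open>Y\<close> stand for the two overlapping
    cliques; injectivity preserves the condition \<open>u \<noteq> v\<close>.\<close>
  have arcs: "map_prod p p ` {(u, v) \<in> X \<times> X \<union> Y \<times> Y. u \<noteq> v}
      = {(u, v) \<in> (p ` X) \<times> (p ` X) \<union> (p ` Y) \<times> (p ` Y). u \<noteq> v}" (is "?L = ?R")
    if "inj_on p (X \<union> Y)" for X Y
  proof
    show "?L \<subseteq> ?R"
      using that by (auto dest: inj_onD)
    show "?R \<subseteq> ?L"
    proof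
      fix e assume "e \<in> ?R"
      then obtain u v where "e = map_prod p p (u, v)" "(u, v) \<in> X \<times> X \<union> Y \<times> Y" "u \<noteq> v"
        by auto
      then show "e \<in> ?L" by blast
    qed
  qed
  have imgs: "p ` (A \<union> C) = A' \<union> C'" "p ` (C \<union> B) = C' \<union> B'" "p ` (A \<union> C \<union> B) = A' \<union> C' \<union> B'"
    using AC CB V by (simp_all only: bij_betw_imp_surj_on)
  define hom where "hom =
    \<lparr>iso_verts = p, iso_arcs = map_prod p p, iso_head = snd, iso_tail = fst\<rparr>"
  have sub: "parcs G \<subseteq> (A \<union> C \<union> B) \<times> (A \<union> C \<union> B)"
    by (auto simp: G two_cliques_def)
  have "pre_digraph.digraph_isomorphism (with_proj G) hom"
    unfolding pre_digraph.digraph_isomorphism_def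
    using wf inj sub by (auto simp: hom_def wf_digraph_wp_iff G(1)
        intro: inj_on_subset[OF map_prod_inj_on])
  moreover have "with_proj (two_cliques A' C' B') = app_iso hom (with_proj G)"
  proof -
    have "map_prod p p ` parcs G = parcs (two_cliques A' C' B')"
      using arcs[of "A \<union> C" "C \<union> B"] inj unfolding imgs
      by (simp add: G(2) two_cliques_def Un_assoc Un_left_absorb)
    then show ?thesis
      using imgs(3) by (simp add: app_iso_def hom_def with_proj_def G(1)) (simp add: two_cliques_def)
  qed
  ultimately show ?thesis
    unfolding digraph_iso_def by blast
qed

text \<open>The parts are pulled back along the vertex map. This serves the converse of the equality
  case: the index of \<open>G\<close> is then computed from its own parts rather than transported
  along the isomorphism.\<close>

lemma digraph_iso_two_cliquesE:
  assumes iso: "digraph_iso (with_proj G) (with_proj (two_cliques A' C' B'))"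
    and disj: "A' \<inter> C' = {}" "A' \<inter> B' = {}" "C' \<inter> B' = {}"
  obtains A C B where "A \<inter> C = {}" "A \<inter> B = {}" "C \<inter> B = {}" "pverts G = A \<union> C \<union> B"
    "parcs G = parcs (two_cliques A C B)" "card A = card A'" "card C = card C'" "card B = card B'"
proof -
  let ?H = "two_cliques A' C' B'"
  obtain hom where hom: "pre_digraph.digraph_isomorphism (with_proj G) hom"
    and H: "with_proj ?H = app_iso hom (with_proj G)"
    using iso unfolding digraph_iso_def by blast
  define p where "p = iso_verts hom"
  have wf: "pair_wf_digraph G" and inj: "inj_on p (pverts G)"
    and ends: "\<And>e. e \<in> parcs G \<Longrightarrow> p (fst e) = iso_tail hom (iso_arcs hom e)"
      "\<And>e. e \<in> parcs G \<Longrightarrow> p (snd e) = iso_head hom (iso_arcs hom e)"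
    using hom by (auto simp: pre_digraph.digraph_isomorphism_def p_def wf_digraph_wp_iff)
  interpret G: pair_wf_digraph G by (rule wf)
  have pH: "pverts ?H = p ` pverts G" "parcs ?H = iso_arcs hom ` parcs G"
    "iso_tail hom = fst" "iso_head hom = snd"
    using arg_cong[OF H, of verts] arg_cong[OF H, of arcs] arg_cong[OF H, of tail]
      arg_cong[OF H, of head] by (simp_all add: p_def)
  \<comment> \<open>The target has \<open>fst\<close> and \<open>snd\<close> as tail and head, so
    the vertex map determines the arc map.\<close>
  have "iso_arcs hom e = map_prod p p e" if "e \<in> parcs G" for e
    using ends[OF that] pH(3,4) by (simp add: prod_eq_iff)
  then have arcsH: "parcs ?H = map_prod p p ` parcs G"
    using pH(2) by simp
  have arc_iff: "(u, v) \<in> parcs G \<longleftrightarrow> (p u, p v) \<in> parcs ?H"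
    if "u \<in> pverts G" "v \<in> pverts G" for u v
  proof
    assume "(p u, p v) \<in> parcs ?H"
    then obtain u' v' where "(u', v') \<in> parcs G" "p u = p u'" "p v = p v'"
      by (auto simp: arcsH)
    then show "(u, v) \<in> parcs G"
      using that inj G.wellformed' by (metis inj_onD)
  qed (force simp: arcsH)
  define pre where "pre X = {v \<in> pverts G. p v \<in> X}" for X
  have card_pre: "card (pre X) = card X" if "X \<subseteq> A' \<union> C' \<union> B'" for X
  proof -
    have "p ` pre X = X"
      using that pH(1) by (auto simp: pre_def two_cliques_def)
    moreover have "inj_on p (pre X)"
      using inj by (rule inj_on_subset) (auto simp: pre_def)
    ultimately show ?thesis using card_image by metis
  qed
  show thesis
  proof (rule that[of "pre A'" "pre C'" "pre B'"])
    show "pverts G = pre A' \<union> pre C' \<union> pre B'"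
      using pH(1) by (auto simp: pre_def two_cliques_def)
    show "parcs G = parcs (two_cliques (pre A') (pre C') (pre B'))"
    proof (rule set_eqI)
      fix e :: "'a \<times> 'a"
      obtain u v where e: "e = (u, v)" by force
      show "e \<in> parcs G \<longleftrightarrow> e \<in> parcs (two_cliques (pre A') (pre C') (pre B'))"
      proof (cases "u \<in> pverts G \<and> v \<in> pverts G")
        case True
        then show ?thesis
          using arc_iff[of u v] inj by (auto simp: e two_cliques_def pre_def inj_on_eq_iff)
      next
        case False
        then show ?thesis
          using G.wellformed' by (auto simp: e two_cliques_def pre_def)
      qed
    qed
  qed (use disj card_pre in \<open>auto simp: pre_def\<close>)
qed

section \<open>The bound and its equality case\<close>

theorem corollary2p7:
  fixes G :: "'a pair_pre_digraph" and n k :: nat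
  assumes "1 \<le> k" and "k \<le> n - 1"
    and "pair_graph G"
    and "Digraph_Component.connected (with_proj G)"
    and "card (pverts G) = n"
    and "edge_connectivity G \<le> k"
  shows "let b =
      real k * sqrt ((real k)\<^sup>2 + (real n - 1)\<^sup>2)
      + real k * (real n - real k - 1) * sqrt ((real n - 1)\<^sup>2 + (real n - 2)\<^sup>2)
      + sqrt 2 / 2 * real k * (real k - 1) * (real n - 1)
      + sqrt 2 / 2 * (real n - real k - 1) * (real n - real k - 2) * (real n - 2)
    in sombor_index G \<le> b
       \<and> (sombor_index G = b \<longleftrightarrow> digraph_iso (with_proj G) (with_proj (K_nk n k)))"
proof -
  define b where "b =
      real k * sqrt ((real k)\<^sup>2 + (real n - 1)\<^sup>2)
      + real k * (real n - real k - 1) * sqrt ((real n - 1)\<^sup>2 + (real n - 2)\<^sup>2)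
      + sqrt 2 / 2 * real k * (real k - 1) * (real n - 1)
      + sqrt 2 / 2 * (real n - real k - 1) * (real n - real k - 2) * (real n - 2)"
  interpret pair_graph G by fact
  note finV = pair_finite_verts
  have n2: "2 \<le> card (pverts G)"
    using assms(1,2,5) by simp
  let ?s = "\<lambda>x. sombor_side (real k) (real n - 1) (real x)"
  let ?core = "sqrt 2 / 2 * real k * (real k - 1) * (real n - 1)"
  \<comment> \<open>At size \<open>1\<close> the clique term of \<open>sombor_side\<close> vanishes;
    at size \<open>n - k - 1\<close> the degree \<open>x + k - 1\<close> becomes
    \<open>n - 2\<close>.\<close>
  have b_eq: "b = ?core + ?s 1 + ?s (n - k - 1)"
    using assms(1,2)
    by (simp add: b_def sombor_side_def of_nat_diff add.commute algebra_simps)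
  have index_eq: "sombor_index (two_cliques A C B) = ?core + ?s (card A) + ?s (card B)"
    and sizes: "card A + card B + k = n" and graph: "pair_graph (two_cliques A C B)"
    if "A \<inter> C = {}" "A \<inter> B = {}" "C \<inter> B = {}" "pverts G = A \<union> C \<union> B" "card C = k" for A C B
  proof -
    have fin: "finite A" "finite C" "finite B"
      using finV that(4) by auto
    have "card (A \<union> C \<union> B) = card (A \<union> C) + card B"
      by (rule card_Un_disjoint) (use that fin in auto)
    also have "card (A \<union> C) = card A + card C"
      by (rule card_Un_disjoint) (use that fin in auto)
    finally show n: "card A + card B + k = n"
      using that assms(5) by simp
    show "sombor_index (two_cliques A C B) = ?core + ?s (card A) + ?s (card B)"
      using sombor_index_two_cliques[OF fin that(1-3)] n[symmetric] that(5)
      by (simp add: add_ac)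
    show "pair_graph (two_cliques A C B)"
      using fin by (rule pair_graph_two_cliques)
  qed
  \<comment> \<open>The alternative \<open>card A = 1\<close> in \<open>ne\<close> accounts for
    \<open>k = n - 1\<close>, where \<open>B\<close> is empty.\<close>
  obtain A C B where part: "A \<inter> C = {}" "A \<inter> B = {}" "C \<inter> B = {}" "pverts G = A \<union> C \<union> B"
      "card C = k" and sub: "parcs G \<subseteq> parcs (two_cliques A C B)"
    and ne: "A \<noteq> {} \<and> B \<noteq> {} \<or> card A = 1"
  proof (cases "k = n - 1")
    case True
    obtain v where v: "v \<in> pverts G"
      using n2 by fastforce
    show thesis
    proof (rule that[of "{v}" "pverts G - {v}" "{}"])
      show "parcs G \<subseteq> parcs (two_cliques {v} (pverts G - {v}) {})"
        using no_loops' wellformed' by (auto simp: two_cliques_def)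
      show "card (pverts G - {v}) = k"
        using v True assms(5) finV by simp
    qed (use v in auto)
  next
    case False
    obtain S where S: "S \<subseteq> pverts G" "S \<noteq> {}" "S \<noteq> pverts G"
      "card (parcs G \<inter> S \<times> (pverts G - S)) \<le> k"
      using edge_cut_of_edge_connectivity_le[OF n2 assms(6)] by blast
    moreover have "k + 2 \<le> card (pverts G)"
      using False assms(1,2,5) by simp
    ultimately show thesis
      by (rule subgraph_two_cliques_of_edge_cut) (use that in blast)
  qed
  note le_H = sombor_index_spanning_subgraph(1)[OF assms(3) graph[OF part] sub]
  note eq_H = sombor_index_spanning_subgraph(2)[OF assms(3) graph[OF part] sub]
  have fin: "finite A" "finite C" "finite B"
    using finV part(4) by auto
  \<comment> \<open>Two sides of size at least \<open>2\<close> lose strictly by convexity;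
    otherwise \<open>ne\<close> forces a side of size exactly \<open>1\<close>.\<close>
  have H_cases: "card A = 1 \<or> card B = 1 \<or> sombor_index (two_cliques A C B) < b"
  proof (cases "2 \<le> card A \<and> 2 \<le> card B")
    case True
    have "?s (card A) + ?s (card B) < ?s 1 + ?s (card A + card B - 1)"
      using assms(1) True
      by (intro strict_mono_diff_superadditive strict_mono_diff_sombor_side) auto
    moreover have "card A + card B - 1 = n - k - 1"
      using sizes[OF part] by simp
    ultimately show ?thesis
      using index_eq[OF part] b_eq by simp
  next
    case False
    then show ?thesis
      using ne fin by (metis One_nat_def Suc_leI card_gt_0_iff le_antisym not_less_eq_eq numeral_2_eq_2)
  qed
  have H_eq: "sombor_index (two_cliques A C B) = b" if "card A = 1 \<or> card B = 1"
  proof -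
    have "card A = 1 \<and> card B = n - k - 1 \<or> card B = 1 \<and> card A = n - k - 1"
      using that sizes[OF part] by linarith
    then show ?thesis
      using index_eq[OF part] b_eq by auto
  qed
  have bound: "sombor_index G \<le> b"
    using le_H H_cases H_eq by fastforce
  have K_parts: "{0} \<inter> {1..k} = {}" "{0} \<inter> {k<..<n} = {}" "{1..k} \<inter> {k<..<n} = {}"
    by auto
  have iso: "digraph_iso (with_proj G) (with_proj (K_nk n k))" if "sombor_index G = b"
  proof -
    \<comment> \<open>If \<open>G\<close> attains \<open>b\<close>, so does the supergraph lying
      between them; this excludes the strict case and, by \<open>eq_H\<close>, any additional
      arc.\<close>
    have arcs: "parcs G = parcs (two_cliques A C B)" and one: "card A = 1 \<or> card B = 1"
      using that le_H H_cases H_eq eq_H by auto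
    show ?thesis
    proof (cases "card A = 1")
      case True
      then show ?thesis
        unfolding K_nk_eq_two_cliques using part fin arcs sizes[OF part]
        by (intro digraph_iso_two_cliquesI[of G A C B]) auto
    next
      \<comment> \<open>Now \<open>B\<close> is the single vertex, so the two sides exchange
        roles.\<close>
      case False
      then show ?thesis
        unfolding K_nk_eq_two_cliques using part fin arcs sizes[OF part] one
        by (intro digraph_iso_two_cliquesI[of G B C A]) (auto simp: two_cliques_commute)
    qed
  qed
  have "sombor_index G = b" if K: "digraph_iso (with_proj G) (with_proj (K_nk n k))"
  proof -
    obtain A C B where part: "A \<inter> C = {}" "A \<inter> B = {}" "C \<inter> B = {}" "pverts G = A \<union> C \<union> B"
      and arcs: "parcs G = parcs (two_cliques A C B)"
      and card: "card A = 1" "card C = k" "card B = n - k - 1"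
      by (rule digraph_iso_two_cliquesE[OF K[unfolded K_nk_eq_two_cliques] K_parts])
         (simp add: card_greaterThanLessThan)
    have "G = two_cliques A C B"
      using part(4) arcs by (simp add: two_cliques_def)
    then show ?thesis
      using index_eq[OF part card(2)] card b_eq by simp
  qed
  with bound iso show ?thesis
    unfolding b_def[symmetric] Let_def by blast
qed

end
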